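(* A cyclically ordered quiver $(Q,\sigma)$ is proper if and only if every (full) subCOQ of $(Q,\sigma)$ supported on a chordless cycle in $K_Q$ is proper.
   Context: A quiver is a finite directed graph without loops or oriented 2-cycles; multiple arrows are allowed. $K_Q$ denotes the underlying undirected simple graph of $Q$. A chordless cycle in $K_Q$ is a cycle (of length at least 3) such that no two non-consecutive vertices of it are adjacent. A cyclic ordering $\sigma=(v_1,\dots,v_n)$ of the vertex set is a linear ordering considered up to cyclic shifts ("clockwise" placement on a circle). A cyclically ordered quiver (COQ) $(Q,\sigma)$ is a quiver with a cyclic ordering of its vertices. A subCOQ is a full subquiver with the induced cyclic ordering. A wiggle transforms $(Q,\sigma)$ into $(Q,\sigma')$ where $\sigma'$ is obtained from $\sigma$ by interchanging two vertices that are consecutive in $\sigma$ and not adjacent in $Q$. Wiggle equivalence is the equivalence relation generated by wiggles. A path $i\to j\to k$ in $Q$ makes a right turn at $j$ if $\sigma=(\dots,i,\dots,j,\dots,k,\dots)$. A vertex $j$ is proper in $(Q,\sigma)$ if every oriented two-arrow path $i\to j\to k$ in $Q$ makes a right turn at $j$. A COQ $(Q,\sigma)$ is called proper if for every vertex $j$ of $Q$ there is a COQ wiggle equivalent to $(Q,\sigma)$ (possibly depending on $j$) in which $j$ is proper. *)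

theory Defs
  imports "Graph_Theory.Digraph_Component"
begin

locale quiver = fin_digraph + loopfree_digraph +
  assumes no_2_cycles: "u \<rightarrow>\<^bsub>G\<^esub> v \<Longrightarrow> \<not> v \<rightarrow>\<^bsub>G\<^esub> u"

text \<open>\<^const>\<open>mk_symmetric\<close> forgets multiplicities and directions of arrows: it yields the symmetric
  set of ordered pairs of adjacent vertices.\<close>

abbreviation underlying_graph :: "('a, 'b) pre_digraph \<Rightarrow> 'a pair_pre_digraph"
  where "underlying_graph Q \<equiv> mk_symmetric Q"

text \<open>In \<^const>\<open>pre_digraph.cycle\<close> a cycle is a closed walk given by its list of arcs, and
  \<open>u, v, u\<close> counts as a cycle of length 2 in a symmetric digraph; hence the length bound. Two
  vertices of the cycle are consecutive iff one of the two arcs between them lies on the walk.\<close>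

abbreviation cycle_verts :: "('a \<times> 'a) list \<Rightarrow> 'a set"
  where "cycle_verts p \<equiv> fst ` set p"

definition chordless_cycle :: "'a pair_pre_digraph \<Rightarrow> ('a \<times> 'a) list \<Rightarrow> bool" where
  "chordless_cycle K p \<longleftrightarrow>
     pre_digraph.cycle (with_proj K) p \<and> length p \<ge> 3 \<and>
     (\<forall>u \<in> cycle_verts p. \<forall>v \<in> cycle_verts p.
        (u, v) \<notin> set p \<and> (v, u) \<notin> set p \<longrightarrow> \<not> u \<rightarrow>\<^bsub>K\<^esub> v)"

text \<open>A cyclic ordering is represented by the set of all linear orderings (lists) obtained from one
  another by cyclic shifts.\<close>

definition cyclic_class :: "'a list \<Rightarrow> 'a list set" where
  "cyclic_class xs = {rotate n xs | n. True}"

definition cyclic_ordering :: "'a set \<Rightarrow> 'a list set \<Rightarrow> bool" where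
  "cyclic_ordering V \<sigma> \<longleftrightarrow> (\<exists>xs. distinct xs \<and> set xs = V \<and> \<sigma> = cyclic_class xs)"

definition coq :: "('a, 'b) pre_digraph \<Rightarrow> 'a list set \<Rightarrow> bool" where
  "coq Q \<sigma> \<longleftrightarrow> quiver Q \<and> cyclic_ordering (verts Q) \<sigma>"

definition induced_ordering :: "'a list set \<Rightarrow> 'a set \<Rightarrow> 'a list set" where
  "induced_ordering \<sigma> W = filter (\<lambda>v. v \<in> W) ` \<sigma>"

text \<open>Consecutive vertices of a cyclic ordering can be shifted to the front of the list.\<close>

inductive wiggle :: "('a, 'b) pre_digraph \<Rightarrow> 'a list set \<Rightarrow> 'a list set \<Rightarrow> bool"
  for Q :: "('a, 'b) pre_digraph" where
  "\<lbrakk> cyclic_ordering (verts Q) \<sigma>; u # v # xs \<in> \<sigma>; \<not> u \<rightarrow>\<^bsub>underlying_graph Q\<^esub> v \<rbrakk>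
     \<Longrightarrow> wiggle Q \<sigma> (cyclic_class (v # u # xs))"

definition wiggle_equivalent :: "('a, 'b) pre_digraph \<Rightarrow> 'a list set \<Rightarrow> 'a list set \<Rightarrow> bool" where
  "wiggle_equivalent Q = equivclp (wiggle Q)"

definition right_turn :: "'a list set \<Rightarrow> 'a \<Rightarrow> 'a \<Rightarrow> 'a \<Rightarrow> bool" where
  "right_turn \<sigma> i j k \<longleftrightarrow> (\<exists>as bs cs ds. as @ [i] @ bs @ [j] @ cs @ [k] @ ds \<in> \<sigma>)"

definition proper_vertex :: "('a, 'b) pre_digraph \<Rightarrow> 'a list set \<Rightarrow> 'a \<Rightarrow> bool" where
  "proper_vertex Q \<sigma> j \<longleftrightarrow> (\<forall>i k. i \<rightarrow>\<^bsub>Q\<^esub> j \<and> j \<rightarrow>\<^bsub>Q\<^esub> k \<longrightarrow> right_turn \<sigma> i j k)"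

definition proper_coq :: "('a, 'b) pre_digraph \<Rightarrow> 'a list set \<Rightarrow> bool" where
  "proper_coq Q \<sigma> \<longleftrightarrow>
     (\<forall>j \<in> verts Q. \<exists>\<sigma>'. wiggle_equivalent Q \<sigma> \<sigma>' \<and> proper_vertex Q \<sigma>' j)"

lemma filter_rotate_in_class: "filter P (rotate n xs) \<in> cyclic_class (filter P xs)"
proof (induction n)
  case 0
  show ?case by (auto simp: cyclic_class_def intro: exI[of _ 0])
next
  case (Suc n)
  then obtain m where m: "filter P (rotate n xs) = rotate m (filter P xs)"
    by (auto simp: cyclic_class_def)
  show ?case
  proof (cases "rotate n xs")
    case Nil
    then show ?thesis using m by (auto simp: cyclic_class_def)
  next
    case (Cons y ys)
    have "filter P (rotate (Suc n) xs) =
        (if P y then rotate (Suc m) (filter P xs) else rotate m (filter P xs))"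
      using Cons m[symmetric] by simp
    then show ?thesis by (auto simp: cyclic_class_def simp del: rotate_Suc)
  qed
qed

lemma rotate_filter_in_image: "rotate n (filter P xs) \<in> filter P ` cyclic_class xs"
proof (induction n arbitrary: xs)
  case 0
  show ?case by (auto simp: cyclic_class_def intro!: image_eqI[of _ _ xs] exI[of _ 0])
next
  case (Suc n)
  show ?case
  proof (cases "filter P xs")
    case Nil
    then show ?thesis
      by (auto simp: cyclic_class_def intro!: image_eqI[of _ _ xs] exI[of _ 0])
  next
    case (Cons y ys)
    then obtain as bs where xs: "xs = as @ y # bs" and as: "filter P as = []" and y: "P y"
      and bs: "ys = filter P bs"
      by (auto simp: filter_eq_Cons_iff)
    let ?zs = "bs @ as @ [y]"
    have zs: "?zs = rotate (length (as @ [y])) xs"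
      using rotate_append[of "as @ [y]" bs] xs by simp
    have "rotate (Suc n) (filter P xs) = rotate n (filter P ?zs)"
      using Cons as y bs by (simp add: rotate1_rotate_swap)
    moreover have "rotate n (filter P ?zs) \<in> filter P ` cyclic_class ?zs"
      by (rule Suc.IH)
    moreover have "cyclic_class ?zs \<subseteq> cyclic_class xs"
      unfolding zs cyclic_class_def by (auto simp only: rotate_rotate)
    ultimately show ?thesis by (metis image_mono subsetD)
  qed
qed

lemma filter_cyclic_class: "filter P ` cyclic_class xs = cyclic_class (filter P xs)"
proof
  show "filter P ` cyclic_class xs \<subseteq> cyclic_class (filter P xs)"
    using filter_rotate_in_class by (fastforce simp: cyclic_class_def)
  show "cyclic_class (filter P xs) \<subseteq> filter P ` cyclic_class xs"
    using rotate_filter_in_image[of _ P xs] by (force simp: cyclic_class_def[of "filter P xs"])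
qed

lemma cyclic_ordering_induced:
  assumes "cyclic_ordering V \<sigma>" "W \<subseteq> V"
  shows "cyclic_ordering W (induced_ordering \<sigma> W)"
proof -
  obtain xs where xs: "distinct xs" "set xs = V" "\<sigma> = cyclic_class xs"
    using assms(1) by (auto simp: cyclic_ordering_def)
  show ?thesis unfolding cyclic_ordering_def induced_ordering_def
    by (rule exI[of _ "filter (\<lambda>v. v \<in> W) xs"]) (use xs assms(2) in \<open>auto simp: filter_cyclic_class\<close>)
qed

lemma coq_induced:
  assumes "coq Q \<sigma>" "W \<subseteq> verts Q"
  shows "coq (Q \<restriction> W) (induced_ordering \<sigma> W)"
proof -
  interpret quiver Q using assms(1) by (simp add: coq_def)
  have "quiver (Q \<restriction> W)"
    using finite_subset[OF assms(2)] no_loops no_2_cycles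
    by unfold_locales (auto simp: arcs_ends_conv)
  then show ?thesis
    using assms cyclic_ordering_induced by (auto simp: coq_def)
qed

end

theory Submission
  imports Defs "Graph_Theory.Vertex_Walk" "HOL-Library.Sublist"
begin

text \<open>Cut the circle at a vertex \<open>j\<close>, so that the ordering reads \<open>j, xs\<close>. Then \<open>j\<close> is proper iff its
  out-neighbours precede its in-neighbours in \<open>xs\<close>. Let \<open>D\<close> be the set of vertices reachable from an
  in-neighbour of \<open>j\<close> by moving rightwards in \<open>xs\<close> along edges. No vertex of \<open>D\<close> is adjacent to a later
  vertex outside \<open>D\<close>, so wiggles can move \<open>D\<close> to the end of \<open>xs\<close>, and this makes \<open>j\<close> proper unless \<open>D\<close>
  contains an out-neighbour of \<open>j\<close>. In that case there is a rightward walk in \<open>xs\<close> from an in-neighbour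
  to an out-neighbour of \<open>j\<close>; a shortest one forms a chordless cycle with \<open>j\<close>. The vertices of this
  cycle occur on the circle in their order along the cycle, so its subCOQ admits no wiggles at all,
  and \<open>j\<close> is not proper in it.\<close>

section \<open>Adjacency of vertices and cyclic orderings as rotation classes\<close>

definition adjacent :: "('a, 'b) pre_digraph \<Rightarrow> 'a \<Rightarrow> 'a \<Rightarrow> bool" where
  "adjacent Q u v \<longleftrightarrow> u \<rightarrow>\<^bsub>underlying_graph Q\<^esub> v"

lemma adjacent_iff: "adjacent Q u v \<longleftrightarrow> u \<rightarrow>\<^bsub>Q\<^esub> v \<or> v \<rightarrow>\<^bsub>Q\<^esub> u"
  by (auto simp: adjacent_def parcs_mk_symmetric arcs_ends_conv)

lemma adjacent_sym: "adjacent Q u v \<Longrightarrow> adjacent Q v u"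
  by (auto simp: adjacent_iff)

lemma dominates_induce_subgraph_iff:
  "u \<rightarrow>\<^bsub>Q \<restriction> W\<^esub> v \<longleftrightarrow> u \<rightarrow>\<^bsub>Q\<^esub> v \<and> u \<in> W \<and> v \<in> W"
  by (auto simp: arcs_ends_conv)

lemma adjacent_induce_subgraph_iff:
  "adjacent (Q \<restriction> W) u v \<longleftrightarrow> adjacent Q u v \<and> u \<in> W \<and> v \<in> W"
  by (auto simp: adjacent_iff dominates_induce_subgraph_iff)

lemma cyclic_class_self: "xs \<in> cyclic_class xs"
  unfolding cyclic_class_def by (auto intro: exI[of _ 0])

lemma cyclic_class_rotate: "cyclic_class (rotate n xs) = cyclic_class xs"
proof
  show "cyclic_class (rotate n xs) \<subseteq> cyclic_class xs"
    by (auto simp: cyclic_class_def rotate_rotate)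
  have "\<exists>m. rotate k xs = rotate m (rotate n xs)" for k
  proof (cases "xs = []")
    case False
    \<comment> \<open>A rotation by \<open>n\<close> is undone by rotating
      \<open>n * (length xs - 1)\<close> further, since the total is a multiple of the
      length.\<close>
    then have "k + n * (length xs - 1) + n = k + n * length xs"
      by (cases xs) auto
    then have "rotate (k + n * (length xs - 1)) (rotate n xs) = rotate k xs"
      by (metis mod_mult_self1 rotate_conv_mod rotate_rotate)
    then show ?thesis by metis
  qed auto
  then show "cyclic_class xs \<subseteq> cyclic_class (rotate n xs)"
    by (auto simp: cyclic_class_def)
qed

lemma cyclic_class_eqI:
  assumes "ys \<in> cyclic_class xs"
  shows "cyclic_class ys = cyclic_class xs"
proof -
  obtain n where "ys = rotate n xs" using assms by (auto simp: cyclic_class_def)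
  then show ?thesis by (simp add: cyclic_class_rotate)
qed

lemma cyclic_ordering_member:
  assumes "cyclic_ordering V \<sigma>" "xs \<in> \<sigma>"
  shows "distinct xs" "set xs = V"
  using assms by (auto simp: cyclic_ordering_def cyclic_class_def)

lemma cyclic_class_append: "cyclic_class (as @ bs) = cyclic_class (bs @ as)"
  by (metis cyclic_class_rotate rotate_append)

lemma mem_cyclic_class_iff: "ys \<in> cyclic_class xs \<longleftrightarrow> (\<exists>as bs. xs = as @ bs \<and> ys = bs @ as)"
proof
  assume "ys \<in> cyclic_class xs"
  then obtain n where "ys = rotate n xs" by (auto simp: cyclic_class_def)
  then show "\<exists>as bs. xs = as @ bs \<and> ys = bs @ as"
    by (metis append_take_drop_id rotate_drop_take)
next
  assume "\<exists>as bs. xs = as @ bs \<and> ys = bs @ as"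
  then show "ys \<in> cyclic_class xs"
    using cyclic_class_append cyclic_class_self by fastforce
qed

text \<open>As \<open>j\<close> occurs only once, it fixes the place where the circle is cut, so the
  list read off after \<open>j\<close> is unique. This lets orderings be handled as plain
  lists.\<close>

lemma cyclic_class_Cons_inject:
  assumes "cyclic_class (j # xs) = cyclic_class (j # ys)" "distinct (j # xs)"
  shows "xs = ys"
proof -
  have "j # ys \<in> cyclic_class (j # xs)" using assms(1) cyclic_class_self by metis
  then obtain as bs where "j # xs = as @ bs" "j # ys = bs @ as"
    by (auto simp: mem_cyclic_class_iff)
  then show ?thesis using assms(2) by (auto simp: Cons_eq_append_conv)
qed

lemma cyclic_class_obtain_Cons:
  assumes "cyclic_ordering V \<sigma>" "j \<in> V"
  obtains xs where "\<sigma> = cyclic_class (j # xs)" "distinct (j # xs)" "set (j # xs) = V"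
proof -
  obtain ys where ys: "distinct ys" "set ys = V" "\<sigma> = cyclic_class ys"
    using assms(1) by (auto simp: cyclic_ordering_def)
  then obtain as bs where ab: "ys = as @ j # bs" using assms(2) by (metis split_list)
  have "\<sigma> = cyclic_class (j # (bs @ as))"
    using ys ab cyclic_class_append[of as "j # bs"] by simp
  moreover have "distinct (j # (bs @ as))" "set (j # (bs @ as)) = V" using ys ab by auto
  ultimately show thesis by (rule that)
qed

lemma induced_ordering_cyclic_class:
  "induced_ordering (cyclic_class xs) W = cyclic_class (filter (\<lambda>v. v \<in> W) xs)"
  unfolding induced_ordering_def by (rule filter_cyclic_class)

text \<open>Read from \<open>j\<close> onwards, the cyclic pattern i, j, k becomes j, k, i. Right
  turns at \<open>j\<close> thus turn into a condition on the order of two entries of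
  \<open>xs\<close>.\<close>

lemma right_turn_cyclic_class_iff:
  assumes "distinct (j # xs)"
  shows "right_turn (cyclic_class (j # xs)) i j k \<longleftrightarrow> (\<exists>as bs cs. xs = as @ k # bs @ i # cs)"
proof
  assume "right_turn (cyclic_class (j # xs)) i j k"
  then obtain as bs cs ds where "as @ i # bs @ j # cs @ k # ds \<in> cyclic_class (j # xs)"
    by (auto simp: right_turn_def)
  then have "cyclic_class (j # xs) = cyclic_class ((as @ i # bs) @ (j # cs @ k # ds))"
    by (auto dest: cyclic_class_eqI)
  also have "\<dots> = cyclic_class (j # (cs @ k # (ds @ as) @ i # bs))"
    by (subst cyclic_class_append) simp
  finally show "\<exists>as bs cs. xs = as @ k # bs @ i # cs"
    using cyclic_class_Cons_inject[OF _ assms] by blast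
next
  assume "\<exists>as bs cs. xs = as @ k # bs @ i # cs"
  then obtain as bs cs where xs: "xs = as @ k # bs @ i # cs" by blast
  have "cyclic_class (j # xs) = cyclic_class ((j # as @ k # bs) @ (i # cs))" by (simp add: xs)
  then have "cyclic_class (j # xs) = cyclic_class ([] @ [i] @ cs @ [j] @ as @ [k] @ bs)"
    by (subst (asm) cyclic_class_append) simp
  then show "right_turn (cyclic_class (j # xs)) i j k"
    unfolding right_turn_def using cyclic_class_self by metis
qed

section \<open>Wiggles as moves on lists\<close>

lemma wiggle_equivalent_refl: "wiggle_equivalent Q \<sigma> \<sigma>"
  by (simp add: wiggle_equivalent_def)

lemma wiggle_equivalent_trans:
  "wiggle_equivalent Q \<sigma> \<tau> \<Longrightarrow> wiggle_equivalent Q \<tau> \<rho> \<Longrightarrow> wiggle_equivalent Q \<sigma> \<rho>"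
  unfolding wiggle_equivalent_def by (rule equivclp_trans)

text \<open>The same swap undoes itself. Inductions over \<open>equivclp\<close> therefore need to
  treat only one direction of each step.\<close>

lemma wiggle_sym:
  assumes "wiggle Q \<sigma> \<tau>"
  shows "wiggle Q \<tau> \<sigma>"
  using assms
proof cases
  case (1 u v xs)
  then have \<sigma>: "\<sigma> = cyclic_class (u # v # xs)"
    by (metis cyclic_class_eqI cyclic_ordering_def)
  have "distinct (u # v # xs)" "set (u # v # xs) = verts Q"
    using cyclic_ordering_member[OF 1(2,3)] by blast+
  then have "cyclic_ordering (verts Q) \<tau>"
    unfolding cyclic_ordering_def 1(1) by (intro exI[of _ "v # u # xs"]) auto
  moreover have "\<not> adjacent Q v u" using 1(4) adjacent_sym by (metis adjacent_def)
  ultimately show ?thesis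
    unfolding 1(1) \<sigma> adjacent_def by (intro wiggle.intros cyclic_class_self)
qed

lemma wiggle_swap:
  assumes "distinct (as @ u # v # bs)" "set (as @ u # v # bs) = verts Q" "\<not> adjacent Q u v"
  shows "wiggle_equivalent Q (cyclic_class (as @ u # v # bs)) (cyclic_class (as @ v # u # bs))"
proof -
  have "cyclic_ordering (verts Q) (cyclic_class (as @ u # v # bs))"
    using assms(1,2) unfolding cyclic_ordering_def by blast
  moreover have "u # v # bs @ as \<in> cyclic_class (as @ u # v # bs)"
    using cyclic_class_append[of as "u # v # bs"] cyclic_class_self[of "u # v # bs @ as"] by simp
  ultimately have "wiggle Q (cyclic_class (as @ u # v # bs)) (cyclic_class (v # u # bs @ as))"
    using assms(3) unfolding adjacent_def by (rule wiggle.intros)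
  moreover have "cyclic_class (v # u # bs @ as) = cyclic_class (as @ v # u # bs)"
    using cyclic_class_append[of "v # u # bs" as] by simp
  ultimately show ?thesis by (simp add: wiggle_equivalent_def r_into_equivclp)
qed

lemma wiggle_move_past:
  assumes "distinct (as @ u # ys @ bs)" "set (as @ u # ys @ bs) = verts Q"
    "\<forall>v \<in> set ys. \<not> adjacent Q u v"
  shows "wiggle_equivalent Q (cyclic_class (as @ u # ys @ bs)) (cyclic_class (as @ ys @ u # bs))"
  using assms
proof (induction ys arbitrary: as)
  case Nil
  show ?case by (simp add: wiggle_equivalent_refl)
next
  case (Cons y ys)
  have "wiggle_equivalent Q (cyclic_class (as @ u # y # (ys @ bs)))
      (cyclic_class (as @ y # u # (ys @ bs)))"
    using Cons.prems by (intro wiggle_swap) auto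
  moreover have "wiggle_equivalent Q (cyclic_class ((as @ [y]) @ u # ys @ bs))
      (cyclic_class ((as @ [y]) @ ys @ u # bs))"
    using Cons.prems by (intro Cons.IH) auto
  ultimately show ?case by (auto intro: wiggle_equivalent_trans)
qed

text \<open>A stable partition done by insertion: once the tail is partitioned, a head satisfying
  \<open>P\<close> moves past the block of entries violating \<open>P\<close>. All of these come
  after it in \<open>xs\<close>, so the hypothesis makes them non-adjacent to it. The prefix
  \<open>as\<close> is arbitrary so that it can absorb the head in the induction.\<close>

lemma wiggle_partition:
  assumes "sorted_wrt (\<lambda>x y. P x \<and> \<not> P y \<longrightarrow> \<not> adjacent Q x y) xs"
    "distinct (as @ xs)" "set (as @ xs) = verts Q"
  shows "wiggle_equivalent Q (cyclic_class (as @ xs))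
    (cyclic_class (as @ filter (\<lambda>v. \<not> P v) xs @ filter P xs))"
  using assms
proof (induction xs arbitrary: as)
  case Nil
  show ?case by (simp add: wiggle_equivalent_refl)
next
  case (Cons x xs)
  let ?F = "filter (\<lambda>v. \<not> P v) xs" and ?T = "filter P xs"
  have IH: "wiggle_equivalent Q (cyclic_class (as @ x # xs)) (cyclic_class (as @ x # ?F @ ?T))"
    using Cons.IH[of "as @ [x]"] Cons.prems by auto
  show ?case
  proof (cases "P x")
    case True
    have "wiggle_equivalent Q (cyclic_class (as @ x # ?F @ ?T)) (cyclic_class (as @ ?F @ x # ?T))"
      using Cons.prems True by (intro wiggle_move_past) auto
    then show ?thesis using IH True by (auto intro: wiggle_equivalent_trans)
  qed (use IH in simp)
qed

section \<open>Restriction to full subquivers\<close>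

lemma wiggle_induced:
  assumes "wiggle Q \<sigma> \<tau>" "W \<subseteq> verts Q"
  shows "wiggle_equivalent (Q \<restriction> W) (induced_ordering \<sigma> W) (induced_ordering \<tau> W)"
  using assms(1)
proof cases
  case (1 u v xs)
  then have \<sigma>: "\<sigma> = cyclic_class (u # v # xs)"
    by (metis cyclic_class_eqI cyclic_ordering_def)
  have ord: "cyclic_ordering (verts (Q \<restriction> W)) (induced_ordering \<sigma> W)"
    using cyclic_ordering_induced[OF 1(2) assms(2)] by simp
  show ?thesis
  proof (cases "u \<in> W \<and> v \<in> W")
    case True
    then have "wiggle (Q \<restriction> W) (induced_ordering \<sigma> W) (induced_ordering \<tau> W)"
      using wiggle.intros[OF ord, of u v "filter (\<lambda>v. v \<in> W) xs", folded adjacent_def]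
        1(1) 1(4)[folded adjacent_def] \<sigma>
      by (simp add: induced_ordering_cyclic_class adjacent_induce_subgraph_iff cyclic_class_self)
    then show ?thesis by (simp add: wiggle_equivalent_def r_into_equivclp)
  next
    case False
    \<comment> \<open>With at most one of \<open>u\<close>, \<open>v\<close> kept, both filtered
      lists coincide; hence the conclusion is an equivalence and not a single wiggle.\<close>
    then show ?thesis
      using 1(1) \<sigma> by (auto simp: induced_ordering_cyclic_class wiggle_equivalent_refl)
  qed
qed

lemma wiggle_equivalent_induced:
  assumes "wiggle_equivalent Q \<sigma> \<tau>" "W \<subseteq> verts Q"
  shows "wiggle_equivalent (Q \<restriction> W) (induced_ordering \<sigma> W) (induced_ordering \<tau> W)"
  using assms(1) unfolding wiggle_equivalent_def[of Q]
proof (induction rule: equivclp_induct)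
  case base
  show ?case by (rule wiggle_equivalent_refl)
next
  case (step \<rho> \<tau>)
  then have "wiggle Q \<rho> \<tau>" using wiggle_sym by blast
  then show ?case using step wiggle_induced assms(2) wiggle_equivalent_trans by metis
qed

lemma right_turn_induced:
  assumes "right_turn \<sigma> i j k" "i \<in> W" "j \<in> W" "k \<in> W"
  shows "right_turn (induced_ordering \<sigma> W) i j k"
proof -
  obtain as bs cs ds where mem: "as @ [i] @ bs @ [j] @ cs @ [k] @ ds \<in> \<sigma>"
    using assms(1) by (auto simp: right_turn_def)
  let ?f = "filter (\<lambda>v. v \<in> W)"
  have "?f (as @ [i] @ bs @ [j] @ cs @ [k] @ ds) \<in> induced_ordering \<sigma> W"
    unfolding induced_ordering_def using mem by (rule imageI)
  then have "?f as @ [i] @ ?f bs @ [j] @ ?f cs @ [k] @ ?f ds \<in> induced_ordering \<sigma> W"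
    using assms by simp
  then show ?thesis unfolding right_turn_def by blast
qed

text \<open>The easy direction, for arbitrary full subquivers: restricting the ordering in which
  \<open>j\<close> is proper keeps its right turns, and the wiggles leading to it restrict as
  well.\<close>

lemma proper_coq_induced:
  assumes "proper_coq Q \<sigma>" "W \<subseteq> verts Q"
  shows "proper_coq (Q \<restriction> W) (induced_ordering \<sigma> W)"
  unfolding proper_coq_def
proof
  fix j assume "j \<in> verts (Q \<restriction> W)"
  then have j: "j \<in> W" by simp
  then obtain \<tau> where \<tau>: "wiggle_equivalent Q \<sigma> \<tau>" "proper_vertex Q \<tau> j"
    using assms by (auto simp: proper_coq_def)
  have "proper_vertex (Q \<restriction> W) (induced_ordering \<tau> W) j"
    unfolding proper_vertex_def dominates_induce_subgraph_iff
    using \<tau>(2) by (auto simp: proper_vertex_def intro!: right_turn_induced)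
  then show "\<exists>\<tau>. wiggle_equivalent (Q \<restriction> W) (induced_ordering \<sigma> W) \<tau> \<and>
      proper_vertex (Q \<restriction> W) \<tau> j"
    using wiggle_equivalent_induced[OF \<tau>(1) assms(2)] by blast
qed

section \<open>Chordless cycles and orderings without wiggles\<close>

lemma cycle_verts_subset:
  assumes "wf_digraph Q" "chordless_cycle (underlying_graph Q) p"
  shows "cycle_verts p \<subseteq> verts Q"
proof -
  interpret S: pair_wf_digraph "underlying_graph Q"
    using assms(1) by (rule wf_digraph.wellformed_mk_symmetric)
  have "set p \<subseteq> parcs (underlying_graph Q)"
    using assms(2) by (auto simp: chordless_cycle_def S.cycle_def S.awalk_def)
  then show ?thesis using S.in_arcsD1 by fastforce
qed

text \<open>Appending the head adds the pair leading from the last entry back to the first. The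
  condition then concerns neighbours on the circle: rotating by one merely moves the first pair to
  the end.\<close>

lemma successively_rotate_closed:
  assumes "successively P (xs @ [hd xs])" "ys \<in> cyclic_class xs"
  shows "successively P (ys @ [hd ys])"
proof -
  have "successively P (rotate n xs @ [hd (rotate n xs)])" for n
  proof (induction n)
    case (Suc n)
    then show ?case
      by (cases "rotate n xs") (auto simp: successively_append_iff successively_Cons hd_append)
  qed (use assms in simp)
  then show ?thesis using assms(2) by (auto simp: cyclic_class_def)
qed

text \<open>Any two vertices that a wiggle could swap are neighbours on the circle, hence adjacent,
  so no wiggle applies.\<close>

lemma wiggle_equivalent_rigid:
  assumes "successively (adjacent Q) (xs @ [hd xs])" "wiggle_equivalent Q (cyclic_class xs) \<tau>"
  shows "\<tau> = cyclic_class xs"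
  using assms(2) unfolding wiggle_equivalent_def
proof (induction rule: equivclp_induct)
  case (step \<rho> \<tau>)
  then have "wiggle Q (cyclic_class xs) \<tau>" using wiggle_sym by blast
  then show ?case
  proof cases
    case (1 u v ys)
    then show ?thesis using successively_rotate_closed[OF assms(1) 1(3)]
      by (simp add: adjacent_def)
  qed
qed simp

section \<open>Sublists and obstructions to properness\<close>

lemma set_mono_subseq: "subseq xs ys \<Longrightarrow> set xs \<subseteq> set ys"
  by (auto simp: subseq_conv_nths dest: in_set_nthsD)

lemma distinct_subseq: "subseq xs ys \<Longrightarrow> distinct ys \<Longrightarrow> distinct xs"
  by (auto simp: subseq_conv_nths)

text \<open>Distinctness ensures that no entry of \<open>ys\<close> recurs in \<open>xs\<close>
  outside the chosen positions. It serves to compute the ordering induced on an obstruction.\<close>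

lemma filter_subseq:
  assumes "subseq ys xs" "distinct xs"
  shows "filter (\<lambda>v. v \<in> set ys) xs = ys"
  using assms
proof (induction rule: list_emb.induct)
  case (list_emb_Cons xs ys y)
  then show ?case using set_mono_subseq by fastforce
next
  case (list_emb_Cons2 x y xs ys)
  then have "filter (\<lambda>v. v \<in> set (x # xs)) ys = filter (\<lambda>v. v \<in> set xs) ys"
    by (intro filter_cong) auto
  then show ?case using list_emb_Cons2 by simp
qed simp

text \<open>This is the rightward walk of the overview, for the circle cut at \<open>j\<close>:
  \<open>subseq\<close> encodes that it only moves to the right. Closing it up through
  \<open>j\<close> gives a cycle, possibly with chords.\<close>

definition obstruction :: "('a, 'b) pre_digraph \<Rightarrow> 'a list \<Rightarrow> 'a \<Rightarrow> 'a list \<Rightarrow> bool" where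
  "obstruction Q xs j cs \<longleftrightarrow> subseq cs xs \<and> cs \<noteq> [] \<and> successively (adjacent Q) cs \<and>
     hd cs \<rightarrow>\<^bsub>Q\<^esub> j \<and> j \<rightarrow>\<^bsub>Q\<^esub> last cs"

section \<open>Vertex lists translated into lists of arcs\<close>

lemma cas_vwalk_arcs:
  "vs \<noteq> [] \<Longrightarrow> pre_digraph.cas (with_proj K) (hd vs) (vwalk_arcs vs) (last vs)"
  by (induction vs rule: vwalk_arcs.induct) (auto simp: pre_digraph.cas.simps)

lemma awalk_verts_vwalk_arcs:
  "vs \<noteq> [] \<Longrightarrow> pre_digraph.awalk_verts (with_proj K) (hd vs) (vwalk_arcs vs) = vs"
  by (induction vs rule: vwalk_arcs.induct) (auto simp: pre_digraph.awalk_verts.simps)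

lemma successively_vwalk_arcs:
  "successively P vs \<Longrightarrow> (u, v) \<in> set (vwalk_arcs vs) \<Longrightarrow> P u v"
  by (induction vs rule: vwalk_arcs.induct) auto

lemma fst_set_vwalk_arcs: "fst ` set (vwalk_arcs vs) = set (butlast vs)"
  by (induction vs rule: vwalk_arcs.induct) auto

lemma in_set_vwalk_arcs: "(x, y) \<in> set (vwalk_arcs (as @ x # y # bs))"
  by (rule in_set_vwalk_arcs_append1) simp

lemma length_vwalk_arcs: "length (vwalk_arcs vs) = length vs - 1"
  by (induction vs rule: vwalk_arcs.induct) auto

section \<open>Obstructions in a quiver\<close>

context quiver
begin

lemma not_adjacent_self: "\<not> adjacent G v v"
  \<comment> \<open>Taking both vertices equal in \<open>no_2_cycles\<close> excludes a loop as
    well.\<close>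
  using no_2_cycles by (auto simp: adjacent_iff)

text \<open>A chord from \<open>x\<close> to \<open>y\<close> is a shortcut: deleting
  \<open>bs\<close> keeps both ends of the walk and leaves a shorter obstruction unless
  \<open>bs\<close> is empty.\<close>

lemma minimal_obstruction_adjacent:
  assumes "obstruction G xs j (as @ x # bs @ y # cs)" "adjacent G x y"
    and min: "\<And>ds. obstruction G xs j ds \<Longrightarrow> length (as @ x # bs @ y # cs) \<le> length ds"
  shows "bs = []"
proof -
  have "subseq (as @ x # y # cs) (as @ x # bs @ y # cs)"
    by (simp add: subseq_append' subseq_drop_many)
  then have "subseq (as @ x # y # cs) xs"
    using assms(1) subseq_order.trans unfolding obstruction_def by blast
  then have "obstruction G xs j (as @ x # y # cs)"
    using assms(1,2) unfolding obstruction_def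
    by (auto simp: successively_append_iff successively_Cons hd_append)
  from min[OF this] show ?thesis by simp
qed

text \<open>If the arrow goes from \<open>x\<close> to \<open>j\<close>, the walk can start at
  \<open>x\<close>; if it goes from \<open>j\<close> to \<open>x\<close>, the walk can stop there.
  Minimality makes the part cut off empty.\<close>

lemma minimal_obstruction_adjacent_apex:
  assumes "obstruction G xs j (as @ x # bs)" "adjacent G j x"
    and min: "\<And>ds. obstruction G xs j ds \<Longrightarrow> length (as @ x # bs) \<le> length ds"
  shows "as = [] \<or> bs = []"
proof -
  have "subseq (x # bs) (as @ x # bs)" "subseq (as @ [x]) (as @ x # bs)"
    by (simp_all add: subseq_append' subseq_drop_many)
  then have "subseq (x # bs) xs" "subseq (as @ [x]) xs"
    using assms(1) subseq_order.trans unfolding obstruction_def by blast+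
  then have "obstruction G xs j (x # bs) \<or> obstruction G xs j (as @ [x])"
    using assms(1,2) unfolding obstruction_def adjacent_iff
    by (auto simp: successively_append_iff successively_Cons hd_append split: if_splits)
  then show ?thesis using min by force
qed

lemma minimal_obstruction_chordless_cycle:
  assumes obs: "obstruction G xs j cs" and xs: "distinct (j # xs)"
    and min: "\<And>ds. obstruction G xs j ds \<Longrightarrow> length cs \<le> length ds"
  shows "chordless_cycle (underlying_graph G) (vwalk_arcs (j # cs @ [j]))"
proof -
  interpret S: pair_wf_digraph "underlying_graph G" ..
  let ?p = "vwalk_arcs (j # cs @ [j])"
  have sub: "subseq cs xs" and ne: "cs \<noteq> []" and succ: "successively (adjacent G) cs"
    and i: "hd cs \<rightarrow> j" and k: "j \<rightarrow> last cs"
    using obs by (auto simp: obstruction_def)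
  have dist: "distinct (j # cs)"
    using sub xs by (auto dest: set_mono_subseq distinct_subseq)
  have succ': "successively (adjacent G) (j # cs @ [j])"
    using succ i k ne by (auto simp: successively_append_iff successively_Cons adjacent_iff)
  have arcs: "set ?p \<subseteq> parcs (underlying_graph G)"
    using successively_vwalk_arcs[OF succ'] by (auto simp: adjacent_def)
  have verts: "cycle_verts ?p = set (j # cs)"
    by (simp add: fst_set_vwalk_arcs butlast_append)
  have "j \<in> verts G" using k adj_in_verts by blast
  \<comment> \<open>\<open>cas\<close> only compares end points of successive arcs; that the arcs
    belong to the graph comes from \<open>arcs\<close>.\<close>
  then have "S.awalk j ?p j"
    using arcs cas_vwalk_arcs[of "j # cs @ [j]" "underlying_graph G"] by (simp add: S.awalk_def)
  moreover have "S.awalk_verts j ?p = j # cs @ [j]"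
    using awalk_verts_vwalk_arcs[of "j # cs @ [j]"] by simp
  ultimately have cycle: "S.cycle ?p" using dist ne by (auto simp: S.cycle_def)
  have len: "3 \<le> length ?p"
  proof -
    \<comment> \<open>Equal ends would form an oriented 2-cycle with \<open>j\<close>. So
      \<open>cs\<close> has at least two vertices, and \<open>j\<close> is the third.\<close>
    have "hd cs \<noteq> last cs" using i k no_2_cycles by metis
    then have "2 \<le> length cs" using ne by (cases cs) (auto simp: Suc_le_eq split: if_splits)
    then show ?thesis by (simp add: length_vwalk_arcs)
  qed
  have apex: "(j, v) \<in> set ?p \<or> (v, j) \<in> set ?p" if v: "v \<in> set cs" "adjacent G j v" for v
  proof -
    obtain as bs where cs: "cs = as @ v # bs" using split_list[OF v(1)] by blast
    have "as = [] \<or> bs = []"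
      by (rule minimal_obstruction_adjacent_apex[OF obs[unfolded cs] v(2) min[unfolded cs]])
    \<comment> \<open>If \<open>as\<close> is empty, \<open>v\<close> is the first vertex of the
      walk and follows \<open>j\<close> on the cycle; if \<open>bs\<close> is empty, it is the last
      one and precedes \<open>j\<close>.\<close>
    then show ?thesis
      using in_set_vwalk_arcs[of j v "[]" "bs @ [j]"] in_set_vwalk_arcs[of v j "j # as" "[]"]
      by (elim disjE) (simp_all add: cs del: vwalk_arcs.simps vwalk_arcs_Cons)
  qed
  have inner: "(u, v) \<in> set ?p" if "cs = as @ u # bs @ v # ds" "adjacent G u v" for u v as bs ds
  proof -
    have "bs = []"
      by (rule minimal_obstruction_adjacent[OF obs[unfolded that(1)] that(2) min[unfolded that(1)]])
    then show ?thesis using in_set_vwalk_arcs[of u v "j # as" "ds @ [j]"] that(1) by simp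
  qed
  have chord: "(u, v) \<in> set ?p \<or> (v, u) \<in> set ?p"
    if uv: "u \<in> set (j # cs)" "v \<in> set (j # cs)" "adjacent G u v" for u v
  proof (cases "u = j \<or> v = j")
    case True
    then show ?thesis using apex uv adjacent_sym[OF uv(3)] not_adjacent_self by auto
  next
    case False
    then obtain as bs where cs: "cs = as @ u # bs" using uv(1) by (auto dest: split_list)
    have "v \<noteq> u" using uv(3) not_adjacent_self by auto
    then consider "v \<in> set as" | "v \<in> set bs" using False uv(2) cs by auto
    then show ?thesis
    proof cases
      case 1
      then obtain a b where "as = a @ v # b" by (metis split_list)
      then show ?thesis using inner[of a v b u bs] cs adjacent_sym[OF uv(3)] by auto
    next
      case 2
      then obtain a b where "bs = a @ v # b" by (metis split_list)
      then show ?thesis using inner[of as u a v b] cs uv(3) by auto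
    qed
  qed
  show ?thesis
    unfolding chordless_cycle_def verts adjacent_def[symmetric] using cycle len chord by blast
qed

lemma obstruction_not_proper:
  assumes obs: "obstruction G xs j cs" and xs: "distinct (j # xs)"
  defines "W \<equiv> set (j # cs)"
  shows "\<not> proper_coq (G \<restriction> W) (induced_ordering (cyclic_class (j # xs)) W)"
proof
  assume proper: "proper_coq (G \<restriction> W) (induced_ordering (cyclic_class (j # xs)) W)"
  have sub: "subseq cs xs" and ne: "cs \<noteq> []" and succ: "successively (adjacent G) cs"
    and i: "hd cs \<rightarrow> j" and k: "j \<rightarrow> last cs"
    using obs by (auto simp: obstruction_def)
  have dist: "distinct (j # cs)"
    using sub xs by (auto dest: set_mono_subseq distinct_subseq)
  have ord: "induced_ordering (cyclic_class (j # xs)) W = cyclic_class (j # cs)"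
    using filter_subseq[of "j # cs" "j # xs"] sub xs
    by (simp only: induced_ordering_cyclic_class W_def) simp
  have "successively (adjacent G) ((j # cs) @ [hd (j # cs)])"
    using succ i k ne by (auto simp: successively_append_iff successively_Cons adjacent_iff)
  then have "successively (adjacent (G \<restriction> W)) ((j # cs) @ [hd (j # cs)])"
    by (rule successively_mono) (auto simp: adjacent_induce_subgraph_iff W_def)
  then have "proper_vertex (G \<restriction> W) (cyclic_class (j # cs)) j"
    using proper wiggle_equivalent_rigid unfolding ord proper_coq_def by (fastforce simp: W_def)
  then have "right_turn (cyclic_class (j # cs)) (hd cs) j (last cs)"
    using i k ne by (auto simp: proper_vertex_def dominates_induce_subgraph_iff W_def)
  then obtain as bs ds where split: "cs = as @ last cs # bs @ hd cs # ds"
    using right_turn_cyclic_class_iff[OF dist] by blast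
  then have "distinct (as @ last cs # bs @ hd cs # ds)" using dist by simp
  \<comment> \<open>If \<open>as\<close> is empty, the two ends of \<open>cs\<close> coincide;
    otherwise \<open>hd cs\<close> occurs both in \<open>as\<close> and after it. Both are
    impossible.\<close>
  moreover have "hd cs = hd (as @ [last cs])"
    by (subst split) (simp add: hd_append)
  moreover have "hd cs \<noteq> last cs" using i k no_2_cycles by metis
  ultimately show False by (cases as) auto
qed

text \<open>The ordering sought moves the reachable set \<open>D\<close> behind all other vertices
  of \<open>xs\<close>. It contains every in-neighbour of \<open>j\<close>, and without obstructions
  it contains no out-neighbour.\<close>

lemma proper_vertex_if_no_obstruction:
  assumes xs: "distinct (j # xs)" "set (j # xs) = verts G" and no: "\<And>cs. \<not> obstruction G xs j cs"
  shows "\<exists>\<tau>. wiggle_equivalent G (cyclic_class (j # xs)) \<tau> \<and> proper_vertex G \<tau> j"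
proof -
  define D where "D y \<longleftrightarrow> (\<exists>cs. subseq cs xs \<and> cs \<noteq> [] \<and> successively (adjacent G) cs \<and>
    hd cs \<rightarrow> j \<and> last cs = y)" for y
  define ys where "ys = filter (\<lambda>v. \<not> D v) xs @ filter D xs"
  have D_closed: "D y" if "xs = as @ x # bs" "y \<in> set bs" "D x" "adjacent G x y" for as x bs y
  proof -
    obtain cs where cs: "subseq cs xs" "cs \<noteq> []" "successively (adjacent G) cs" "hd cs \<rightarrow> j"
      "last cs = x"
      using \<open>D x\<close> by (auto simp: D_def)
    \<comment> \<open>The walk ends at \<open>x\<close>, which does not occur in \<open>bs\<close>;
      so all of it lies within \<open>as @ [x]\<close>, and a neighbour \<open>y\<close> further
      right can be appended.\<close>
    then have "subseq cs ((as @ [x]) @ bs)" using that(1) by simp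
    then obtain c1 c2 where c: "cs = c1 @ c2" "subseq c1 (as @ [x])" "subseq c2 bs"
      by (rule subseq_appendE)
    have "x \<notin> set bs" using xs that(1) by auto
    then have "c2 = []" using c cs(5) by (metis last_appendR last_in_set set_mono_subseq subsetD)
    then have "subseq (cs @ [y]) xs"
      using c that(1,2) list_emb_append_mono[of "(=)" cs "as @ [x]" "[y]" bs]
      by (simp add: subseq_singleton_left)
    then show "D y"
      unfolding D_def using cs that(4)
      by (intro exI[of _ "cs @ [y]"]) (auto simp: successively_append_iff)
  qed
  have "sorted_wrt (\<lambda>x y. D x \<and> \<not> D y \<longrightarrow> \<not> adjacent G x y) xs"
    unfolding sorted_wrt_iff_nth_less
  proof (intro allI impI)
    fix a b assume ab: "a < b" "b < length xs" "D (xs ! a) \<and> \<not> D (xs ! b)"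
    then have "xs = take a xs @ xs ! a # drop (Suc a) xs" by (simp add: id_take_nth_drop)
    moreover have "xs ! b \<in> set (drop (Suc a) xs)"
      using ab nth_mem[of "b - Suc a" "drop (Suc a) xs"] by simp
    ultimately show "\<not> adjacent G (xs ! a) (xs ! b)" using D_closed ab(3) by blast
  qed
  then have "wiggle_equivalent G (cyclic_class ([j] @ xs)) (cyclic_class ([j] @ ys))"
    unfolding ys_def using xs by (intro wiggle_partition) auto
  moreover have "proper_vertex G (cyclic_class (j # ys)) j"
    unfolding proper_vertex_def
  proof (intro allI impI, elim conjE)
    fix i k assume ik: "i \<rightarrow> j" "j \<rightarrow> k"
    have "i \<noteq> j" "k \<noteq> j" using ik no_2_cycles by blast+
    then have mem: "i \<in> set xs" "k \<in> set xs" using ik adj_in_verts xs(2) by auto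
    have "D i"
      \<comment> \<open>The one-vertex walk shows that an in-neighbour is reachable.\<close>
      unfolding D_def using ik(1) mem(1) by (intro exI[of _ "[i]"]) (simp add: subseq_singleton_left)
    moreover have "\<not> D k" using no ik(2) by (auto simp: D_def obstruction_def)
    ultimately have "i \<in> set (filter D xs)" "k \<in> set (filter (\<lambda>v. \<not> D v) xs)" using mem by auto
    then obtain as bs cs ds where "filter (\<lambda>v. \<not> D v) xs = as @ k # bs" "filter D xs = cs @ i # ds"
      by (metis split_list)
    then have "ys = as @ k # (bs @ cs) @ i # ds" by (simp add: ys_def)
    moreover have "distinct (j # ys)" using xs by (auto simp: ys_def)
    ultimately show "right_turn (cyclic_class (j # ys)) i j k"
      by (subst right_turn_cyclic_class_iff) blast+
  qed
  ultimately show ?thesis by auto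
qed

end

theorem theorem11p17:
  fixes Q :: "('a, 'b) pre_digraph" and \<sigma> :: "'a list set"
  assumes "coq Q \<sigma>"
  shows "proper_coq Q \<sigma> \<longleftrightarrow>
    (\<forall>p. chordless_cycle (underlying_graph Q) p \<longrightarrow>
      proper_coq (Q \<restriction> cycle_verts p) (induced_ordering \<sigma> (cycle_verts p)))"
proof -
  interpret quiver Q using assms by (simp add: coq_def)
  have ord: "cyclic_ordering (verts Q) \<sigma>" using assms by (simp add: coq_def)
  have wf: "wf_digraph Q" by unfold_locales
  show ?thesis
  proof
    assume "proper_coq Q \<sigma>"
    then show "\<forall>p. chordless_cycle (underlying_graph Q) p \<longrightarrow>
        proper_coq (Q \<restriction> cycle_verts p) (induced_ordering \<sigma> (cycle_verts p))"
      using proper_coq_induced cycle_verts_subset[OF wf] by blast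
  next
    assume cycles: "\<forall>p. chordless_cycle (underlying_graph Q) p \<longrightarrow>
        proper_coq (Q \<restriction> cycle_verts p) (induced_ordering \<sigma> (cycle_verts p))"
    show "proper_coq Q \<sigma>"
      unfolding proper_coq_def
    proof
      fix j assume "j \<in> verts Q"
      then obtain xs where xs: "\<sigma> = cyclic_class (j # xs)" "distinct (j # xs)" "set (j # xs) = verts Q"
        using cyclic_class_obtain_Cons[OF ord] by metis
      have "\<not> obstruction Q xs j cs" for cs
      proof
        assume "obstruction Q xs j cs"
        \<comment> \<open>Replacing \<open>cs\<close> by a shortest obstruction makes the resulting
          cycle chordless, so that the hypothesis on cycles applies.\<close>
        then obtain ds where ds: "obstruction Q xs j ds"
          and min: "\<And>es. obstruction Q xs j es \<Longrightarrow> length ds \<le> length es"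
          using ex_has_least_nat[of "obstruction Q xs j" cs length] by blast
        have "cycle_verts (vwalk_arcs (j # ds @ [j])) = set (j # ds)"
          by (simp add: fst_set_vwalk_arcs butlast_append)
        then show False
          using cycles minimal_obstruction_chordless_cycle[OF ds xs(2) min]
            obstruction_not_proper[OF ds xs(2)] xs(1) by metis
      qed
      then show "\<exists>\<tau>. wiggle_equivalent Q \<sigma> \<tau> \<and> proper_vertex Q \<tau> j"
        using proper_vertex_if_no_obstruction[OF xs(2,3)] xs(1) by blast
    qed
  qed
qed

end
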